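(* Let $q$ be a complex number with $|q|<1$, and let $$\omega(q):=\sum_{n=0}^{\infty}\frac{q^{2n^2+2n}}{(q;q^2)_{n+1}^2}.$$ Then $$\sum_{n=1}^{\infty}\frac{q^n}{(1-q^n)(q^{n+1};q)_n(q^{2n+2};q^2)_{\infty}}=q\,\omega(q).$$
   Context: Notation: $(a;q)_n:=\prod_{j=0}^{n-1}(1-aq^j)$ for $n\ge 0$ (empty product equal to 1) and $(a;q)_\infty:=\lim_{n\to\infty}(a;q)_n$. *)

theory Defs
  imports "HOL-Analysis.Analysis"
begin

definition qpoch :: "complex \<Rightarrow> complex \<Rightarrow> nat \<Rightarrow> complex" where
  "qpoch a q n = (\<Prod>j<n. 1 - a * q ^ j)"

text \<open>As a value of \<^const>\<open>lim\<close> this is meaningful only when the finite products converge;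
  the lemma below shows that they do whenever the base has norm less than 1.\<close>

definition qpoch_inf :: "complex \<Rightarrow> complex \<Rightarrow> complex" where
  "qpoch_inf a q = lim (\<lambda>n. qpoch a q n)"

lemma qpoch_tendsto_qpoch_inf:
  assumes "norm q < 1"
  shows "(\<lambda>n. qpoch a q n) \<longlonglongrightarrow> qpoch_inf a q"
proof -
  have "summable (\<lambda>j. norm (- (a * q ^ j)))"
    using assms by (simp add: norm_mult norm_power summable_mult summable_geometric)
  then have "convergent_prod (\<lambda>j. 1 - a * q ^ j)"
    by (intro abs_convergent_prod_imp_convergent_prod)
       (simp add: abs_convergent_prod_conv_summable)
  then have "convergent (\<lambda>n. \<Prod>j\<le>n. 1 - a * q ^ j)"
    by (rule convergent_prod_imp_convergent)
  then have "convergent (\<lambda>n. qpoch a q (Suc n))"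
    by (simp add: qpoch_def lessThan_Suc_atMost)
  then have "convergent (\<lambda>n. qpoch a q n)"
    by (simp only: convergent_Suc_iff)
  then show ?thesis
    by (simp add: qpoch_inf_def convergent_LIMSEQ_iff)
qed

definition omega_term :: "complex \<Rightarrow> nat \<Rightarrow> complex" where
  "omega_term q n = q ^ (2 * n\<^sup>2 + 2 * n) / (qpoch q (q\<^sup>2) (n + 1))\<^sup>2"

definition omega :: "complex \<Rightarrow> complex" where
  "omega q = (\<Sum>n. omega_term q n)"

end

theory Submission
  imports Defs
begin

text \<open>For \<open>|z| \<le> 1\<close> let \<open>L(z)\<close> be the left-hand side with every \<open>1 - q\<^sup>k\<close> replaced by \<open>1 - z q\<^sup>k\<close>.
  Up to a telescoping sum, \<open>(1 - z q) L(z)\<close> equals \<open>q L(z q\<^sup>2)\<close>, and evaluating that sum gives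
  \<open>(1 - z q) L(z) = q + q L(z q\<^sup>2)\<close>. Iteration yields \<open>L(1) = \<Sum> q\<^sup>n / (q;q\<^sup>2)\<^sub>n\<close> over \<open>n \<ge> 1\<close>,
  and the case \<open>\<alpha> = 0\<close> of the Rogers-Fine identity, itself obtained by iterating a functional
  equation, turns this into \<open>q \<omega>(q)\<close>.\<close>

text \<open>Unrolling the recurrence \<open>M\<close> times leaves the remainder
  \<open>(\<Prod>i<M. c i) * x M\<close>, which vanishes in the limit because \<open>x\<close> is
  bounded. Both functional equations below are solved this way.\<close>

lemma iterated_recurrence_sums:
  fixes x b c :: "nat \<Rightarrow> 'a :: real_normed_field"
  assumes rec: "\<And>m. x m = b m + c m * x (Suc m)"
    and c0: "(\<lambda>m. \<Prod>i<m. c i) \<longlonglongrightarrow> 0"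
    and x_bd: "\<And>m. norm (x m) \<le> B"
  shows "(\<lambda>m. (\<Prod>i<m. c i) * b m) sums x 0"
proof -
  have partial: "(\<Sum>m<M. (\<Prod>i<m. c i) * b m) = x 0 - (\<Prod>i<M. c i) * x M" for M
  proof (induction M)
    case (Suc M)
    show ?case
      using Suc by (subst (asm) rec [of M]) (simp add: algebra_simps)
  qed simp
  have "(\<lambda>M. (\<Prod>i<M. c i) * x M) \<longlonglongrightarrow> 0"
    using x_bd by (intro tendsto_0_le [OF c0, of _ B] always_eventually allI)
      (simp add: norm_mult mult_left_mono)
  then have "(\<lambda>M. x 0 - (\<Prod>i<M. c i) * x M) \<longlonglongrightarrow> x 0 - 0"
    by (intro tendsto_intros)
  then show ?thesis
    by (simp add: sums_def partial)
qed

section \<open>q-Pochhammer symbols: shifts, uniform bounds and limits\<close>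

lemma qpoch_0 [simp]: "qpoch a q 0 = 1"
  by (simp add: qpoch_def)

lemma qpoch_Suc: "qpoch a q (Suc n) = qpoch a q n * (1 - a * q ^ n)"
  by (simp add: qpoch_def)

lemma qpoch_Suc_shift: "qpoch a q (Suc n) = (1 - a) * qpoch (a * q) q n"
  unfolding qpoch_def by (subst prod.lessThan_Suc_shift) (simp add: mult_ac)

lemma qpoch_inf_shift:
  assumes "norm q < 1"
  shows "qpoch_inf a q = (1 - a) * qpoch_inf (a * q) q"
proof (rule LIMSEQ_unique)
  show "(\<lambda>n. qpoch a q (Suc n)) \<longlonglongrightarrow> qpoch_inf a q"
    using qpoch_tendsto_qpoch_inf [OF assms] by (rule LIMSEQ_Suc)
  show "(\<lambda>n. qpoch a q (Suc n)) \<longlonglongrightarrow> (1 - a) * qpoch_inf (a * q) q"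
    unfolding qpoch_Suc_shift
    by (intro tendsto_intros qpoch_tendsto_qpoch_inf assms)
qed

lemma sum_power_le:
  fixes r :: real
  assumes "0 \<le> r" "r < 1"
  shows "(\<Sum>j<n. r ^ j) \<le> 1 / (1 - r)"
  using sum_le_suminf [OF summable_geometric, of r "{..<n}"] assms by (simp add: suminf_geometric)

text \<open>With \<open>y = x / (1 - r)\<close>, the product \<open>(1 + y) * (1 - x)\<close>
  exceeds 1 by \<open>x * (r - x) / (1 - r)\<close>, and \<open>1 + y \<le> exp y\<close>. The
  exponential form turns lower bounds for products into sums of exponents.\<close>

lemma one_minus_ge_exp:
  fixes r x :: real
  assumes "0 \<le> x" "x \<le> r" "r < 1"
  shows "exp (- (x / (1 - r))) \<le> 1 - x"
proof -
  have "1 \<le> (1 + x / (1 - r)) * (1 - x)"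
  proof -
    have "(1 + x / (1 - r)) * (1 - x) = 1 + x * (r - x) / (1 - r)"
      using assms by (simp add: field_simps)
    then show ?thesis
      using assms by simp
  qed
  also have "\<dots> \<le> exp (x / (1 - r)) * (1 - x)"
    using assms by (intro mult_right_mono exp_ge_add_one_self) auto
  finally show ?thesis
    by (simp add: exp_minus field_simps)
qed

text \<open>Each factor has norm at least \<open>1 - r * r ^ j\<close>, hence at least
  \<open>exp (- (r * r ^ j / (1 - r)))\<close>, and the geometric series bounds the total exponent
  by \<open>r / (1 - r)\<^sup>2\<close>. The bound is positive and free of \<open>n\<close>, so it
  passes to the infinite product, gives nonvanishing, and controls all denominators
  uniformly.\<close>

lemma norm_qpoch_ge:
  assumes "norm a \<le> r" "norm q \<le> r" "r < 1"
  shows "exp (- (r / (1 - r)\<^sup>2)) \<le> norm (qpoch a q n)"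
proof -
  have r: "0 \<le> r"
    using assms(1) norm_ge_zero order_trans by blast
  have "r / (1 - r) * (\<Sum>j<n. r ^ j) \<le> r / (1 - r) * (1 / (1 - r))"
    using assms r by (intro mult_left_mono sum_power_le) auto
  then have "exp (- (r / (1 - r)\<^sup>2)) \<le> exp (- (r / (1 - r) * (\<Sum>j<n. r ^ j)))"
    by (simp add: power2_eq_square)
  also have "\<dots> = (\<Prod>j<n. exp (- (r * r ^ j / (1 - r))))"
    by (simp add: exp_sum [symmetric] sum_negf sum_distrib_left)
  also have "\<dots> \<le> (\<Prod>j<n. norm (1 - a * q ^ j))"
  proof (intro prod_mono conjI)
    fix j
    have "norm (a * q ^ j) \<le> r * r ^ j"
      unfolding norm_mult norm_power using assms r by (intro mult_mono power_mono) auto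
    moreover have "norm (1 :: complex) - norm (a * q ^ j) \<le> norm (1 - a * q ^ j)"
      by (rule norm_triangle_ineq2)
    moreover have "r * r ^ j \<le> r"
      using assms r by (simp add: mult_left_le power_le_one)
    ultimately show "exp (- (r * r ^ j / (1 - r))) \<le> norm (1 - a * q ^ j)"
      using one_minus_ge_exp [of "r * r ^ j" r] assms r by simp
  qed simp
  also have "\<dots> = norm (qpoch a q n)"
    by (simp add: qpoch_def prod_norm)
  finally show ?thesis .
qed

lemma norm_qpoch_inf_ge:
  assumes "norm a \<le> r" "norm q \<le> r" "r < 1"
  shows "exp (- (r / (1 - r)\<^sup>2)) \<le> norm (qpoch_inf a q)"
  using assms
  by (intro tendsto_lowerbound [OF tendsto_norm [OF qpoch_tendsto_qpoch_inf]])
     (auto intro: norm_qpoch_ge always_eventually)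

lemma qpoch_nonzero:
  assumes "norm a < 1" "norm q < 1"
  shows "qpoch a q n \<noteq> 0"
  using norm_qpoch_ge [of a "max (norm a) (norm q)" q n] assms by auto

lemma qpoch_inf_nonzero:
  assumes "norm a < 1" "norm q < 1"
  shows "qpoch_inf a q \<noteq> 0"
  using norm_qpoch_inf_ge [of a "max (norm a) (norm q)" q] assms by auto

text \<open>Expanding the product and taking norms termwise replaces each factor by
  \<open>1 + norm (a * q ^ j)\<close>, and \<open>1 + y \<le> exp y\<close> does the rest. Again the
  bound does not depend on \<open>n\<close>.\<close>

lemma norm_qpoch_minus_one_le:
  assumes "norm q < 1"
  shows "norm (qpoch a q n - 1) \<le> exp (norm a / (1 - norm q)) - 1"
proof -
  have "norm (qpoch a q n - 1) \<le> (\<Prod>j<n. 1 + norm (- (a * q ^ j))) - 1"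
    using norm_prod_minus1_le_prod_minus1 [of "\<lambda>j. - (a * q ^ j)" "{..<n}"]
    by (simp add: qpoch_def)
  also have "(\<Prod>j<n. 1 + norm (- (a * q ^ j))) \<le> (\<Prod>j<n. exp (norm a * norm q ^ j))"
    by (intro prod_mono) (auto simp: norm_mult norm_power add_nonneg_nonneg)
  also have "\<dots> = exp (norm a * (\<Sum>j<n. norm q ^ j))"
    by (simp add: exp_sum sum_distrib_left)
  also have "\<dots> \<le> exp (norm a * (1 / (1 - norm q)))"
    unfolding exp_le_cancel_iff using assms by (intro mult_left_mono sum_power_le) auto
  finally show ?thesis
    by simp
qed

lemma norm_qpoch_inf_minus_one_le:
  assumes "norm q < 1"
  shows "norm (qpoch_inf a q - 1) \<le> exp (norm a / (1 - norm q)) - 1"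
  using assms
  by (intro tendsto_upperbound [OF tendsto_norm [OF tendsto_diff [OF qpoch_tendsto_qpoch_inf tendsto_const]]])
     (auto intro: norm_qpoch_minus_one_le always_eventually)

lemma exp_minus_one_tendsto_0:
  assumes "a \<longlonglongrightarrow> (0 :: complex)"
  shows "(\<lambda>k. exp (norm (a k) / c) - 1) \<longlonglongrightarrow> 0"
proof -
  have "(\<lambda>k. norm (a k) * (1 / c)) \<longlonglongrightarrow> 0 * (1 / c)"
    by (intro tendsto_intros tendsto_norm_zero assms)
  then have "(\<lambda>k. exp (norm (a k) / c) - 1) \<longlonglongrightarrow> exp 0 - 1"
    by (intro tendsto_intros) simp
  then show ?thesis
    by simp
qed

text \<open>The length \<open>f k\<close> may vary arbitrarily with \<open>k\<close>, since the
  preceding estimate is uniform in the length. In \<open>tail_gf\<close> the length grows with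
  \<open>k\<close>.\<close>

lemma qpoch_tendsto_1:
  assumes "norm q < 1" "a \<longlonglongrightarrow> 0"
  shows "(\<lambda>k. qpoch (a k) q (f k)) \<longlonglongrightarrow> 1"
  by (subst LIM_zero_iff [symmetric], rule Lim_null_comparison [OF _ exp_minus_one_tendsto_0 [OF assms(2)]])
     (auto intro!: always_eventually norm_qpoch_minus_one_le assms)

lemma qpoch_inf_tendsto_1:
  assumes "norm q < 1" "a \<longlonglongrightarrow> 0"
  shows "(\<lambda>k. qpoch_inf (a k) q) \<longlonglongrightarrow> 1"
  by (subst LIM_zero_iff [symmetric], rule Lim_null_comparison [OF _ exp_minus_one_tendsto_0 [OF assms(2)]])
     (auto intro!: always_eventually norm_qpoch_inf_minus_one_le assms)

section \<open>The left-hand side with parameter z and its functional equation\<close>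

text \<open>Generating function of the partitions into parts greater than \<open>k\<close> whose odd parts are less
  than \<open>2k\<close>, with \<open>z\<close> counting the parts.\<close>

definition tail_gf :: "complex \<Rightarrow> complex \<Rightarrow> nat \<Rightarrow> complex" where
  "tail_gf q z k = 1 / (qpoch (z * q ^ (k + 1)) q k * qpoch_inf (z * q ^ (2 * k + 2)) (q\<^sup>2))"

text \<open>At \<open>z = 1\<close> and \<open>n > 0\<close>, this is the generating function of
  partitions with smallest part \<open>n\<close> and all odd parts less than \<open>2 * n\<close>.
  The variable \<open>z\<close> counts all parts except one copy of the smallest.\<close>

definition smallest_part_term :: "complex \<Rightarrow> complex \<Rightarrow> nat \<Rightarrow> complex" where
  "smallest_part_term q z n = q ^ n * (tail_gf q z n / (1 - z * q ^ n))"

definition smallest_part_sum :: "complex \<Rightarrow> complex \<Rightarrow> complex" where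
  "smallest_part_sum q z = (\<Sum>k. smallest_part_term q z (k + 1))"

context
  fixes q :: complex
  assumes q: "norm q < 1"
begin

lemma norm_power2_less_1: "norm (q\<^sup>2) < 1"
  using q by (simp add: norm_power power_less_one_iff abs_square_less_1)

lemma norm_mult_power_le:
  assumes "norm z \<le> 1" "0 < n"
  shows "norm (z * q ^ n) \<le> norm q"
proof -
  have "norm (z * q ^ n) = norm z * norm q ^ n"
    by (simp add: norm_mult norm_power)
  also have "\<dots> \<le> 1 * norm q ^ 1"
    using assms q by (intro mult_mono power_decreasing) auto
  finally show ?thesis
    by simp
qed

lemma one_minus_mult_power_nonzero:
  assumes "norm z \<le> 1" "0 < n"
  shows "1 - z * q ^ n \<noteq> 0"
  using norm_mult_power_le [OF assms] q by auto

text \<open>The admissible parts for \<open>k\<close> are \<open>k + 1, ..., 2 * k\<close> and the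
  even numbers from \<open>2 * k + 2\<close> on. Passing to \<open>k + 1\<close> removes the part
  \<open>k + 1\<close> and admits the part \<open>2 * k + 1\<close>.\<close>

lemma tail_gf_step:
  assumes "norm z \<le> 1"
  shows "tail_gf q z k = (1 - z * q ^ (2 * k + 1)) * (tail_gf q z (k + 1) / (1 - z * q ^ (k + 1)))"
proof -
  have "(1 - z * q ^ (k + 1)) * qpoch (z * q ^ (k + 2)) q (k + 1) = qpoch (z * q ^ (k + 1)) q (k + 2)"
    using qpoch_Suc_shift [of "z * q ^ (k + 1)" q "k + 1"] by (simp add: mult_ac)
  also have "\<dots> = qpoch (z * q ^ (k + 1)) q k * (1 - z * q ^ (2 * k + 1)) * (1 - z * q ^ (2 * k + 2))"
    by (simp add: qpoch_Suc mult_ac flip: power_add mult_2)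
  finally have fin: "(1 - z * q ^ (k + 1)) * qpoch (z * q ^ (k + 2)) q (k + 1) = \<dots>" .
  have inf: "qpoch_inf (z * q ^ (2 * k + 2)) (q\<^sup>2)
      = (1 - z * q ^ (2 * k + 2)) * qpoch_inf (z * q ^ (2 * k + 4)) (q\<^sup>2)"
    using qpoch_inf_shift [OF norm_power2_less_1, of "z * q ^ (2 * k + 2)"]
    by (simp add: mult_ac numeral_eq_Suc)
  have "tail_gf q z (k + 1) / (1 - z * q ^ (k + 1))
      = 1 / ((1 - z * q ^ (k + 1)) * qpoch (z * q ^ (k + 2)) q (k + 1)
              * qpoch_inf (z * q ^ (2 * k + 4)) (q\<^sup>2))"
    by (simp add: tail_gf_def mult_ac numeral_eq_Suc)
  also have "\<dots> = 1 / ((1 - z * q ^ (2 * k + 1))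
              * (qpoch (z * q ^ (k + 1)) q k * qpoch_inf (z * q ^ (2 * k + 2)) (q\<^sup>2)))"
    unfolding fin inf by (simp add: mult_ac)
  finally show ?thesis
    using one_minus_mult_power_nonzero [OF assms, of "2 * k + 1"] by (simp add: tail_gf_def)
qed

lemma tail_gf_shift:
  "tail_gf q (z * q\<^sup>2) (k + 1) / (1 - z * q\<^sup>2 * q ^ (k + 1)) = tail_gf q z (k + 2)"
proof -
  have arg: "z * q\<^sup>2 * q ^ i = z * q ^ (i + 2)" for i
    by (simp add: power_add mult_ac power2_eq_square)
  have "qpoch (z * q ^ (k + 3)) q (k + 2) = (1 - z * q ^ (k + 3)) * qpoch (z * q ^ (k + 4)) q (k + 1)"
    using qpoch_Suc_shift [of "z * q ^ (k + 3)" q "k + 1"] by (simp add: mult_ac numeral_eq_Suc)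
  then show ?thesis
    unfolding tail_gf_def arg by (simp add: mult_ac numeral_eq_Suc)
qed

lemma tail_gf_tendsto_1: "tail_gf q z \<longlonglongrightarrow> 1"
proof -
  have q_lim: "(\<lambda>k. q ^ k) \<longlonglongrightarrow> 0"
    using q by (rule LIMSEQ_power_zero)
  have "(\<lambda>k. z * q ^ (k + 1)) \<longlonglongrightarrow> z * 0"
    by (intro tendsto_intros LIMSEQ_ignore_initial_segment [OF q_lim])
  then have "(\<lambda>k. qpoch (z * q ^ (k + 1)) q k) \<longlonglongrightarrow> 1"
    by (intro qpoch_tendsto_1 q) simp
  moreover have "filterlim (\<lambda>k. 2 * k + 2 :: nat) sequentially sequentially"
    by (rule filterlim_subseq) (simp add: strict_mono_def)
  then have "(\<lambda>k. z * q ^ (2 * k + 2)) \<longlonglongrightarrow> z * 0"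
    by (intro tendsto_intros filterlim_compose [OF q_lim])
  then have "(\<lambda>k. qpoch_inf (z * q ^ (2 * k + 2)) (q\<^sup>2)) \<longlonglongrightarrow> 1"
    by (intro qpoch_inf_tendsto_1 norm_power2_less_1) simp
  ultimately have "(\<lambda>k. 1 / (qpoch (z * q ^ (k + 1)) q k * qpoch_inf (z * q ^ (2 * k + 2)) (q\<^sup>2)))
      \<longlonglongrightarrow> 1 / (1 * 1)"
    by (intro tendsto_intros) auto
  then show ?thesis
    by (simp add: tail_gf_def [abs_def])
qed

text \<open>The constant \<open>C\<close> depends on \<open>q\<close> only. Uniformity in
  \<open>z\<close> makes the sums bounded along the sequence \<open>z * (q\<^sup>2) ^ m\<close>, as
  the iteration requires.\<close>

lemma norm_smallest_part_term_le:
  obtains C where "\<And>z k. norm z \<le> 1 \<Longrightarrow> norm (smallest_part_term q z (k + 1)) \<le> C * norm q ^ k"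
proof
  fix z :: complex and k
  assume z: "norm z \<le> 1"
  define r where "r = norm q"
  define e where "e = exp (- (r / (1 - r)\<^sup>2))"
  have r: "0 \<le> r" "r < 1"
    using q by (auto simp: r_def)
  have e: "0 < e"
    by (simp add: e_def)
  have base: "norm (z * q ^ n) \<le> r" if "0 < n" for n
    using norm_mult_power_le [OF z that] by (simp add: r_def)
  have "norm (q\<^sup>2) \<le> r"
    using norm_mult_power_le [of 1 2] by (simp add: r_def)
  then have "e \<le> norm (qpoch_inf (z * q ^ (2 * (k + 1) + 2)) (q\<^sup>2))"
    unfolding e_def using r by (intro norm_qpoch_inf_ge base) auto
  moreover have "e \<le> norm (qpoch (z * q ^ ((k + 1) + 1)) q (k + 1))"
    unfolding e_def using r by (intro norm_qpoch_ge base) (auto simp: r_def)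
  moreover have "1 - r \<le> norm (1 - z * q ^ (k + 1))"
    using norm_triangle_ineq2 [of 1 "z * q ^ (k + 1)"] base [of "k + 1"] by simp
  ultimately have "(1 - r) * (e * e) \<le> norm (1 - z * q ^ (k + 1)) *
      (norm (qpoch (z * q ^ ((k + 1) + 1)) q (k + 1)) * norm (qpoch_inf (z * q ^ (2 * (k + 1) + 2)) (q\<^sup>2)))"
    using r e by (intro mult_mono) auto
  then have "norm (tail_gf q z (k + 1) / (1 - z * q ^ (k + 1))) \<le> 1 / ((1 - r) * (e * e))"
    using r e unfolding tail_gf_def norm_divide norm_mult norm_one
    by (simp add: mult_ac frac_le)
  then have "norm (smallest_part_term q z (k + 1)) \<le> r ^ k * (1 / ((1 - r) * (e * e)))"
    unfolding smallest_part_term_def norm_mult norm_power r_def [symmetric]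
    using r by (intro mult_mono power_decreasing) auto
  then show "norm (smallest_part_term q z (k + 1))
      \<le> 1 / ((1 - norm q) * (exp (- (norm q / (1 - norm q)\<^sup>2)) * exp (- (norm q / (1 - norm q)\<^sup>2)))) * norm q ^ k"
    by (simp add: r_def e_def mult_ac)
qed

lemma summable_smallest_part_term:
  assumes "norm z \<le> 1"
  shows "summable (\<lambda>k. smallest_part_term q z (k + 1))"
proof -
  obtain C where C: "\<And>z k. norm z \<le> 1 \<Longrightarrow> norm (smallest_part_term q z (k + 1)) \<le> C * norm q ^ k"
    using norm_smallest_part_term_le by blast
  have "summable (\<lambda>k. C * norm q ^ k)"
    using q by (intro summable_mult summable_geometric) simp
  then show ?thesis
    by (rule summable_comparison_test' [where N = 0]) (rule C [OF assms])
qed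

lemma norm_smallest_part_sum_le:
  obtains B where "\<And>z. norm z \<le> 1 \<Longrightarrow> norm (smallest_part_sum q z) \<le> B"
proof -
  obtain C where C: "\<And>z k. norm z \<le> 1 \<Longrightarrow> norm (smallest_part_term q z (k + 1)) \<le> C * norm q ^ k"
    using norm_smallest_part_term_le by blast
  show thesis
  proof
    fix z :: complex
    assume "norm z \<le> 1"
    then show "norm (smallest_part_sum q z) \<le> (\<Sum>k. C * norm q ^ k)"
      unfolding smallest_part_sum_def using q C by (intro norm_suminf_le summable_mult) auto
  qed
qed

text \<open>The difference of the two series, taken term by term, telescopes through
  \<open>f\<close>. Since \<open>f\<close> starts at 0 and tends to \<open>- q\<close>, its total is
  the inhomogeneous term \<open>q\<close>.\<close>

lemma smallest_part_sum_rec: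
  assumes z: "norm z \<le> 1"
  shows "(1 - z * q) * smallest_part_sum q z = q + q * smallest_part_sum q (z * q\<^sup>2)"
proof -
  define w where "w = tail_gf q z"
  define f where "f k = q ^ (k + 1) * w (k + 1) - q * w k" for k
  have zq: "norm (z * q\<^sup>2) \<le> 1"
    using norm_mult_power_le [OF z, of 2] q by simp
  have f_diff: "f k - f (Suc k)
      = (1 - z * q) * smallest_part_term q z (k + 1) - q * smallest_part_term q (z * q\<^sup>2) (k + 1)" for k
  proof -
    \<comment> \<open>By \<open>tail_gf_step\<close>, both \<open>w k\<close> and
      \<open>w (k + 1)\<close> are polynomial multiples of \<open>u\<close>. In
      \<open>f k - f (Suc k)\<close> the terms with \<open>w k\<close> and \<open>w (k + 1)\<close>
      then collapse to \<open>(1 - z * q) * (q ^ (k + 1) * u)\<close>, while the term with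
      \<open>w (k + 2)\<close> belongs to the sum at \<open>z * q\<^sup>2\<close>.\<close>
    define u where "u = w (k + 1) / (1 - z * q ^ (k + 1))"
    have w1: "w (k + 1) = (1 - z * q ^ (k + 1)) * u"
      using one_minus_mult_power_nonzero [OF z, of "k + 1"] by (simp add: u_def)
    have w0: "w k = (1 - z * q ^ (2 * k + 1)) * u"
      unfolding w_def u_def by (rule tail_gf_step [OF z])
    have "smallest_part_term q z (k + 1) = q ^ (k + 1) * u"
      by (simp add: smallest_part_term_def u_def w_def)
    moreover have "smallest_part_term q (z * q\<^sup>2) (k + 1) = q ^ (k + 1) * w (k + 2)"
      unfolding smallest_part_term_def tail_gf_shift by (simp add: w_def)
    moreover have "f k - f (Suc k) = q ^ (k + 1) * w (k + 1) - q * w k + q * w (k + 1) - q * (q ^ (k + 1) * w (k + 2))"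
      by (simp add: f_def)
    moreover have "q ^ (k + 1) * w (k + 1) - q * w k + q * w (k + 1) = (1 - z * q) * (q ^ (k + 1) * u)"
    proof -
      have q_powers: "q ^ (k + 1) = q * q ^ k" "q ^ (2 * k + 1) = q * (q ^ k * q ^ k)"
        by (simp_all add: mult_2 power_add)
      show ?thesis
        unfolding w0 w1 q_powers by (simp add: algebra_simps)
    qed
    ultimately show ?thesis
      by simp
  qed
  have "w \<longlonglongrightarrow> 1"
    unfolding w_def by (rule tail_gf_tendsto_1)
  then have "f \<longlonglongrightarrow> 0 * 1 - q * 1"
    unfolding f_def [abs_def]
    by (intro tendsto_intros LIMSEQ_ignore_initial_segment [of w]
          LIMSEQ_ignore_initial_segment [of "\<lambda>k. q ^ k"] LIMSEQ_power_zero q)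
  then have "(\<lambda>k. f k - f (Suc k)) sums (f 0 - - q)"
    by (intro telescope_sums') simp
  moreover have "w 0 = w 1"
    using tail_gf_step [OF z, of 0] one_minus_mult_power_nonzero [OF z, of 1] by (simp add: w_def)
  then have "f 0 = 0"
    by (simp add: f_def)
  moreover have "(\<lambda>k. f k - f (Suc k)) sums
      ((1 - z * q) * smallest_part_sum q z - q * smallest_part_sum q (z * q\<^sup>2))"
    unfolding f_diff smallest_part_sum_def
    by (intro sums_diff sums_mult summable_sums summable_smallest_part_term z zq)
  ultimately have "(1 - z * q) * smallest_part_sum q z - q * smallest_part_sum q (z * q\<^sup>2) = q"
    by (simp add: sums_unique2)
  then show ?thesis
    by (simp add: algebra_simps)
qed

text \<open>The functional equation is iterated along \<open>z * (q\<^sup>2) ^ m\<close>. After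
  division by \<open>1 - z * q * (q\<^sup>2) ^ m\<close>, the constant term and the coefficient are
  the same number \<open>c m\<close>.\<close>

lemma smallest_part_sum_expansion:
  assumes z: "norm z \<le> 1"
  shows "(\<lambda>n. q ^ (n + 1) / qpoch (z * q) (q\<^sup>2) (n + 1)) sums smallest_part_sum q z"
proof -
  define c where "c m = q / (1 - z * q * (q\<^sup>2) ^ m)" for m
  define x where "x m = smallest_part_sum q (z * (q\<^sup>2) ^ m)" for m
  have zm: "norm (z * (q\<^sup>2) ^ m) \<le> 1" for m
    using z q by (simp add: norm_mult norm_power mult_le_one power_le_one)
  have rec: "x m = c m + c m * x (Suc m)" for m
  proof -
    define D where "D = 1 - z * q * (q\<^sup>2) ^ m"
    have "D * x m = q + q * x (Suc m)"
      using smallest_part_sum_rec [OF zm [of m]] by (simp add: x_def D_def mult_ac)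
    moreover have "D \<noteq> 0"
      using one_minus_mult_power_nonzero [OF zm [of m], of 1] by (simp add: D_def mult_ac)
    ultimately have "x m = (q + q * x (Suc m)) / D"
      by (simp add: nonzero_eq_divide_eq mult.commute)
    then show ?thesis
      by (simp add: c_def D_def add_divide_distrib)
  qed
  have prod_c: "(\<Prod>i<m. c i) = q ^ m / qpoch (z * q) (q\<^sup>2) m" for m
    by (simp add: c_def qpoch_def prod_dividef)
  have base: "norm (z * q) < 1"
    using norm_mult_power_le [OF z, of 1] q by simp
  \<comment> \<open>The numerator tends to 0 while the denominator converges to a nonzero infinite
    product.\<close>
  have "(\<lambda>m. q ^ m / qpoch (z * q) (q\<^sup>2) m) \<longlonglongrightarrow> 0 / qpoch_inf (z * q) (q\<^sup>2)"
    by (intro tendsto_intros LIMSEQ_power_zero q qpoch_tendsto_qpoch_inf norm_power2_less_1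
        qpoch_inf_nonzero base)
  then have "(\<lambda>m. \<Prod>i<m. c i) \<longlonglongrightarrow> 0"
    unfolding prod_c by simp
  moreover obtain B where "\<And>z. norm z \<le> 1 \<Longrightarrow> norm (smallest_part_sum q z) \<le> B"
    using norm_smallest_part_sum_le by blast
  then have "norm (x m) \<le> B" for m
    using zm by (simp add: x_def)
  ultimately have "(\<lambda>m. (\<Prod>i<m. c i) * c m) sums x 0"
    by (rule iterated_recurrence_sums [where x = x and b = c and c = c, OF rec])
  moreover have "(\<Prod>i<m. c i) * c m = q ^ (m + 1) / qpoch (z * q) (q\<^sup>2) (m + 1)" for m
    unfolding prod_c by (simp add: c_def qpoch_Suc)
  ultimately show ?thesis
    by (simp add: x_def)
qed

end

section \<open>The Rogers-Fine identity at \<alpha> = 0\<close>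

lemma norm_power_over_qpoch_le:
  assumes "norm b \<le> r" "norm t \<le> r" "norm q \<le> r" "r < 1"
  shows "norm (t ^ n / qpoch b q (n + 1)) \<le> r ^ n / exp (- (r / (1 - r)\<^sup>2))"
proof -
  have "0 \<le> r"
    using assms(1) norm_ge_zero order_trans by blast
  then show ?thesis
    unfolding norm_divide norm_power using assms by (intro frac_le power_mono norm_qpoch_ge) auto
qed

lemma summable_power_over_qpoch:
  assumes "norm b < 1" "norm t < 1" "norm q < 1"
  shows "summable (\<lambda>n. t ^ n / qpoch b q (n + 1))"
proof -
  define r where "r = max (norm b) (max (norm t) (norm q))"
  have r: "norm b \<le> r" "norm t \<le> r" "norm q \<le> r" "r < 1"
    using assms by (auto simp: r_def)
  have "0 \<le> r"
    using r(1) norm_ge_zero order_trans by blast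
  then have "norm r < 1"
    using r by simp
  then have "summable (\<lambda>n. r ^ n / exp (- (r / (1 - r)\<^sup>2)))"
    by (intro summable_divide summable_geometric)
  then show ?thesis
    by (rule summable_comparison_test' [where N = 0]) (rule norm_power_over_qpoch_le [OF r])
qed

lemma norm_mult_less_1:
  fixes a b :: "'a :: real_normed_div_algebra"
  assumes "norm a < 1" "norm b < 1"
  shows "norm (a * b) < 1"
  unfolding norm_mult using assms
  by (intro le_less_trans [OF mult_left_le_one_le assms(2)]) auto

text \<open>Over the common denominator \<open>qpoch b q (n + 2)\<close>, the combination
  \<open>a (Suc n) - t * a n\<close> retains only \<open>t ^ (n + 1) * (b * q ^ (n + 1))\<close>.
  Splitting off the factor \<open>1 - b\<close> makes this a multiple of the \<open>n\<close>-th
  term of the series at \<open>b * q\<close> and \<open>t * q\<close>.\<close>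

lemma rogers_fine_rec:
  assumes b: "norm b < 1" and t: "norm t < 1" and q: "norm q < 1"
  defines "G \<equiv> \<lambda>b t. \<Sum>n. t ^ n / qpoch b q (n + 1)"
  shows "(1 - b) * (1 - t) * G b t = 1 + b * t * q * G (b * q) (t * q)"
proof -
  define a where "a n = t ^ n / qpoch b q (n + 1)" for n
  have bq: "norm (b * q) < 1" and tq: "norm (t * q) < 1"
    using b t q by (simp_all add: norm_mult_less_1)
  have [simp]: "b \<noteq> 1"
    using b by auto
  have a: "summable a"
    unfolding a_def [abs_def] by (rule summable_power_over_qpoch [OF b t q])
  have diff: "a (Suc n) - t * a n = b * t * q / (1 - b) * ((t * q) ^ n / qpoch (b * q) q (n + 1))" for n
  proof -
    have P: "qpoch b q (n + 2) = qpoch b q (n + 1) * (1 - b * q ^ (n + 1))"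
      using qpoch_Suc [of b q "n + 1"] by simp
    then have "1 - b * q ^ (n + 1) \<noteq> 0"
      using qpoch_nonzero [OF b q, of "n + 2"] by auto
    then have "t * a n = t ^ (n + 1) * (1 - b * q ^ (n + 1)) / qpoch b q (n + 2)"
      unfolding a_def P by simp
    moreover have "a (Suc n) = t ^ (n + 1) / qpoch b q (n + 2)"
      by (simp add: a_def)
    ultimately have "a (Suc n) - t * a n = t ^ (n + 1) * (b * q ^ (n + 1)) / qpoch b q (n + 2)"
      by (simp add: right_diff_distrib diff_divide_distrib)
    also have "qpoch b q (n + 2) = (1 - b) * qpoch (b * q) q (n + 1)"
      using qpoch_Suc_shift [of b q "n + 1"] by simp
    finally show ?thesis
      by (simp add: power_mult_distrib mult_ac)
  qed
  have G: "a sums G b t"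
    using summable_sums [OF a] by (simp add: G_def a_def [abs_def])
  then have "(\<lambda>n. a (Suc n)) sums (G b t - a 0)"
    by (simp add: sums_Suc_iff)
  moreover have "(\<lambda>n. t * a n) sums (t * G b t)"
    using G by (rule sums_mult)
  ultimately have "(\<lambda>n. a (Suc n) - t * a n) sums (G b t - a 0 - t * G b t)"
    by (rule sums_diff)
  moreover have "(\<lambda>n. a (Suc n) - t * a n) sums (b * t * q / (1 - b) * G (b * q) (t * q))"
    unfolding diff G_def by (intro sums_mult summable_sums summable_power_over_qpoch bq tq q)
  ultimately have "G b t - a 0 - t * G b t = b * t * q / (1 - b) * G (b * q) (t * q)"
    by (rule sums_unique2)
  moreover have "a 0 = 1 / (1 - b)"
    by (simp add: a_def qpoch_def)
  ultimately have "(1 - t) * G b t = (1 + b * t * q * G (b * q) (t * q)) / (1 - b)"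
    by (simp add: algebra_simps add_divide_distrib)
  then show ?thesis
    by (simp add: mult.assoc)
qed

text \<open>This iterates \<open>rogers_fine_rec\<close> along the pairs \<open>b * q ^ m\<close>,
  \<open>t * q ^ m\<close>; the result is symmetric in \<open>b\<close> and
  \<open>t\<close>.\<close>

lemma rogers_fine_0:
  assumes b: "norm b < 1" and t: "norm t < 1" and q: "norm q < 1"
  shows "(\<lambda>n. (b * t) ^ n * q ^ n\<^sup>2 / (qpoch b q (n + 1) * qpoch t q (n + 1)))
    sums (\<Sum>n. t ^ n / qpoch b q (n + 1))"
proof -
  define d where "d m = 1 / ((1 - b * q ^ m) * (1 - t * q ^ m))" for m
  define c where "c m = b * t * q ^ (2 * m + 1) * d m" for m
  define x where "x m = (\<Sum>n. (t * q ^ m) ^ n / qpoch (b * q ^ m) q (n + 1))" for m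
  \<comment> \<open>A single \<open>r < 1\<close> dominates \<open>q\<close> and all the shifted
    parameters, so one geometric series bounds every \<open>x m\<close>.\<close>
  define r where "r = max (norm b) (max (norm t) (norm q))"
  have r: "norm b \<le> r" "norm t \<le> r" "norm q \<le> r" "r < 1"
    using assms by (auto simp: r_def)
  have r0: "0 \<le> r"
    using r(1) norm_ge_zero order_trans by blast
  have norm_le: "norm (y * q ^ m) \<le> r" if "norm y \<le> r" for y m
  proof -
    have "norm (y * q ^ m) \<le> r * 1"
      unfolding norm_mult norm_power using that q r0 by (intro mult_mono power_le_one) auto
    then show ?thesis
      by simp
  qed
  have rec: "x m = d m + c m * x (Suc m)" for m
  proof -
    have bm: "norm (b * q ^ m) < 1" and tm: "norm (t * q ^ m) < 1"
      using norm_le r by (meson le_less_trans)+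
    then have nz: "(1 - b * q ^ m) * (1 - t * q ^ m) \<noteq> 0"
      by auto
    have coeff: "b * t * q ^ (2 * m + 1) = b * q ^ m * (t * q ^ m) * q"
      by (simp add: mult_2 power_add)
    have x_Suc: "x (Suc m) = (\<Sum>n. (t * q ^ m * q) ^ n / qpoch (b * q ^ m * q) q (n + 1))"
      unfolding x_def power_Suc2 mult.assoc ..
    have "(1 - b * q ^ m) * (1 - t * q ^ m) * x m = 1 + b * t * q ^ (2 * m + 1) * x (Suc m)"
      unfolding coeff x_Suc unfolding x_def by (rule rogers_fine_rec [OF bm tm q])
    then have "x m * ((1 - b * q ^ m) * (1 - t * q ^ m)) = 1 + b * t * q ^ (2 * m + 1) * x (Suc m)"
      by (subst mult.commute)
    then have "x m = (1 + b * t * q ^ (2 * m + 1) * x (Suc m)) / ((1 - b * q ^ m) * (1 - t * q ^ m))"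
      by (rule eq_divide_imp [OF nz])
    then show ?thesis
      by (simp add: c_def d_def add_divide_distrib)
  qed
  \<comment> \<open>The square in the exponent is the sum of the first \<open>m\<close> odd numbers,
    contributed by the factors \<open>q ^ (2 * i + 1)\<close>.\<close>
  have prod_c: "(\<Prod>i<m. c i) = (b * t) ^ m * q ^ m\<^sup>2 / (qpoch b q m * qpoch t q m)" for m
  proof (induction m)
    case (Suc m)
    have "(Suc m)\<^sup>2 = m\<^sup>2 + (2 * m + 1)"
      by (simp add: power2_eq_square)
    then have numerator: "(b * t) ^ Suc m * q ^ (Suc m)\<^sup>2 = (b * t) ^ m * q ^ m\<^sup>2 * (b * t * q ^ (2 * m + 1))"
      by (simp only: power_add [of q "m\<^sup>2"] power_Suc mult_ac)
    have denominator: "qpoch b q (Suc m) * qpoch t q (Suc m)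
        = qpoch b q m * qpoch t q m * ((1 - b * q ^ m) * (1 - t * q ^ m))"
      by (simp only: qpoch_Suc mult_ac)
    have "c m = b * t * q ^ (2 * m + 1) / ((1 - b * q ^ m) * (1 - t * q ^ m))"
      by (simp only: c_def d_def times_divide_eq_right mult_1_right)
    then show ?case
      by (simp only: numerator denominator prod.lessThan_Suc Suc.IH times_divide_times_eq)
  qed simp
  have "norm (b * t) < 1"
    using b t by (rule norm_mult_less_1)
  then have "(\<lambda>m. (b * t) ^ m) \<longlonglongrightarrow> 0"
    by (rule LIMSEQ_power_zero)
  then have "(\<lambda>m. (b * t) ^ m * q ^ m\<^sup>2) \<longlonglongrightarrow> 0"
    by (rule tendsto_0_le [where K = 1])
      (use q in \<open>simp add: norm_mult norm_power mult_left_le power_le_one\<close>)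
  then have "(\<lambda>m. (b * t) ^ m * q ^ m\<^sup>2 / (qpoch b q m * qpoch t q m))
      \<longlonglongrightarrow> 0 / (qpoch_inf b q * qpoch_inf t q)"
    using qpoch_inf_nonzero [OF b q] qpoch_inf_nonzero [OF t q]
    by (intro tendsto_divide tendsto_mult qpoch_tendsto_qpoch_inf q) auto
  then have "(\<lambda>m. \<Prod>i<m. c i) \<longlonglongrightarrow> 0"
    unfolding prod_c by simp
  moreover have "norm (x m) \<le> (\<Sum>n. r ^ n / exp (- (r / (1 - r)\<^sup>2)))" for m
    unfolding x_def using r r0 norm_le
    by (intro norm_suminf_le norm_power_over_qpoch_le summable_divide summable_geometric) auto
  ultimately have "(\<lambda>m. (\<Prod>i<m. c i) * d m) sums x 0"
    by (rule iterated_recurrence_sums [where x = x and b = d and c = c, OF rec])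
  moreover have "(\<Prod>i<m. c i) * d m
      = (b * t) ^ m * q ^ m\<^sup>2 / (qpoch b q (m + 1) * qpoch t q (m + 1))" for m
    unfolding prod_c d_def by (simp add: qpoch_Suc mult_ac)
  ultimately show ?thesis
    by (simp add: x_def)
qed

section \<open>Specialization to z = 1 and comparison with the series for omega\<close>

theorem theorem3p1:
  fixes q :: complex
  assumes "norm q < 1"
  shows "summable (omega_term q) \<and>
    (\<lambda>k. let n = k + 1 in
        q ^ n / ((1 - q ^ n) * qpoch (q ^ (n + 1)) q n * qpoch_inf (q ^ (2 * n + 2)) (q\<^sup>2)))
      sums (q * omega q)"
proof -
  define S where "S = (\<Sum>n. q ^ n / qpoch q (q\<^sup>2) (n + 1))"
  \<comment> \<open>Rogers-Fine is used with base \<open>q\<^sup>2\<close> and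
    \<open>b = t = q\<close>; the two equal denominators form the square in
    \<open>omega_term\<close>.\<close>
  have "(\<lambda>n. (q * q) ^ n * (q\<^sup>2) ^ n\<^sup>2 / (qpoch q (q\<^sup>2) (n + 1) * qpoch q (q\<^sup>2) (n + 1))) sums S"
    unfolding S_def by (intro rogers_fine_0 assms norm_power2_less_1)
  moreover have "(q * q) ^ n * (q\<^sup>2) ^ n\<^sup>2 = q ^ (2 * n\<^sup>2 + 2 * n)" for n
    unfolding power2_eq_square [of q, symmetric] power_mult [symmetric] power_add [symmetric]
    by (simp add: add.commute)
  ultimately have omega: "omega_term q sums S"
    by (simp add: omega_term_def [abs_def] power2_eq_square)
  have expansion: "(\<lambda>n. q ^ (n + 1) / qpoch q (q\<^sup>2) (n + 1)) sums smallest_part_sum q 1"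
    using smallest_part_sum_expansion [OF assms, of 1] by simp
  \<comment> \<open>The expansion is \<open>q\<close> times the series \<open>S\<close>. Cancelling
    that factor needs \<open>q \<noteq> 0\<close>; for \<open>q = 0\<close> every term of the
    expansion vanishes, so both sides are 0.\<close>
  have "smallest_part_sum q 1 = q * omega q"
  proof (cases "q = 0")
    case True
    then show ?thesis
      using expansion sums_unique by fastforce
  next
    case False
    have "(\<lambda>n. inverse q * (q ^ (n + 1) / qpoch q (q\<^sup>2) (n + 1))) sums (inverse q * smallest_part_sum q 1)"
      by (intro sums_mult expansion)
    then have "(\<lambda>n. q ^ n / qpoch q (q\<^sup>2) (n + 1)) sums (inverse q * smallest_part_sum q 1)"
      using False by (simp add: field_simps)
    then have "S = inverse q * smallest_part_sum q 1"
      unfolding S_def by (rule sums_unique [symmetric])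
    then show ?thesis
      using False sums_unique [OF omega] by (simp add: omega_def)
  qed
  moreover have "(\<lambda>k. smallest_part_term q 1 (k + 1)) sums smallest_part_sum q 1"
    unfolding smallest_part_sum_def by (intro summable_sums summable_smallest_part_term assms) simp
  ultimately show ?thesis
    using omega by (auto simp: sums_iff smallest_part_term_def tail_gf_def Let_def mult_ac)
qed

end
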